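(* Let $n$ virtual machines $vm_1,\dots,vm_n$, each with a fixed starting time $ts_i$, a fixed duration $dur_i$, non-preemptive execution and constant CPU utilization, be scheduled on $m$ identical physical machines $M_1,\dots,M_m$ whose power consumption is $P(u)=P_{idle}+(P_{max}-P_{idle})u$ at CPU utilization $u\in[0,1]$. For a feasible schedule $S$, let $T_j(S)$ be the total busy time of $M_j$ and let $e_i(S)$ be the energy consumption for running $vm_i$ on the physical machine to which $S$ allocates it. Let $E_0>0$ be the energy consumption of a physical machine in a time unit, which is the same constant for all machines. Then minimizing the total energy consumption $$E_0\sum_{j=1}^m T_j(S)+\sum_{i=1}^n e_i(S)$$ over feasible schedules $S$ is equivalent to minimizing the sum of total busy times $\sum_{j=1}^m T_j(S)$ over feasible schedules $S$; that is, a feasible schedule minimizes the first quantity if and only if it minimizes the second.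
   Context: Each virtual machine $vm_i$ has a demand vector $(x_{i,1},\dots,x_{i,d})$ of nonnegative reals and occupies the fixed time interval $[ts_i,\,ts_i+dur_i]$. Each physical machine $M_j$ has a capacity vector $(y_{j,1},\dots,y_{j,d})$; the machines are identical, so these vectors, the power function $P$, and $E_0$ do not depend on $j$. A schedule $S$ assigns each virtual machine to exactly one physical machine; it is feasible if, at every time and for every resource $r\in\{1,\dots,d\}$, the total demand for resource $r$ of the virtual machines running on $M_j$ at that time is at most $y_{j,r}$, for every $j$. The total busy time of $M_j$ under $S$ is the length (Lebesgue measure) of the union of the execution intervals of the virtual machines assigned to it: $T_j(S)=\mathrm{span}\left(\bigcup_{i:\,S(i)=j}[ts_i,\,ts_i+dur_i]\right)$, where $\mathrm{span}([a,b])=b-a$ and the span of a union of non-overlapping intervals is the sum of their spans. The energy of a virtual machine $vm_i$ with constant CPU utilization $u_i\in[0,1]$ (constant in time and the same on each of the identical machines) run on the machine to which it is allocated is $e_i(S)=\int_{ts_i}^{ts_i+dur_i}P(u_i)\,dt$. *)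

theory Defs
  imports "HOL-Analysis.Analysis"
begin

text \<open>
  Virtual machines are numbered \<open>1..n\<close>, physical machines \<open>1..m\<close>, resources \<open>1..d\<close>;
  families indexed by these are functions on \<^typ>\<open>nat\<close> of which only the values
  in range matter.
\<close>

record virtual_machine =
  start_time :: real
  duration :: real
  demand :: "nat \<Rightarrow> real"
  cpu_utilization :: real

record physical_machine =
  capacity :: "nat \<Rightarrow> real"
  P_idle :: real
  P_max :: real

definition exec_interval :: "virtual_machine \<Rightarrow> real set" where
  "exec_interval v = {start_time v .. start_time v + duration v}"

definition power :: "physical_machine \<Rightarrow> real \<Rightarrow> real" where
  "power M u = P_idle M + (P_max M - P_idle M) * u"

definition schedules :: "nat \<Rightarrow> nat \<Rightarrow> (nat \<Rightarrow> nat) set" where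
  "schedules n m = {1..n} \<rightarrow>\<^sub>E {1..m}"

definition feasible ::
  "nat \<Rightarrow> nat \<Rightarrow> nat \<Rightarrow> (nat \<Rightarrow> virtual_machine) \<Rightarrow> (nat \<Rightarrow> physical_machine)
    \<Rightarrow> (nat \<Rightarrow> nat) \<Rightarrow> bool" where
  "feasible n m d vm M S \<longleftrightarrow>
     S \<in> schedules n m \<and>
     (\<forall>t::real. \<forall>j\<in>{1..m}. \<forall>r\<in>{1..d}.
        (\<Sum>i | i \<in> {1..n} \<and> S i = j \<and> t \<in> exec_interval (vm i). demand (vm i) r)
          \<le> capacity (M j) r)"

definition busy_time ::
  "nat \<Rightarrow> (nat \<Rightarrow> virtual_machine) \<Rightarrow> (nat \<Rightarrow> nat) \<Rightarrow> nat \<Rightarrow> real" where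
  "busy_time n vm S j =
     measure lborel (\<Union>i\<in>{i \<in> {1..n}. S i = j}. exec_interval (vm i))"

definition vm_energy ::
  "(nat \<Rightarrow> virtual_machine) \<Rightarrow> (nat \<Rightarrow> physical_machine) \<Rightarrow> (nat \<Rightarrow> nat) \<Rightarrow> nat \<Rightarrow> real" where
  "vm_energy vm M S i =
     integral (exec_interval (vm i)) (\<lambda>t. power (M (S i)) (cpu_utilization (vm i)))"

definition total_busy_time ::
  "nat \<Rightarrow> nat \<Rightarrow> (nat \<Rightarrow> virtual_machine) \<Rightarrow> (nat \<Rightarrow> nat) \<Rightarrow> real" where
  "total_busy_time n m vm S = (\<Sum>j=1..m. busy_time n vm S j)"

definition total_energy ::
  "nat \<Rightarrow> nat \<Rightarrow> (nat \<Rightarrow> virtual_machine) \<Rightarrow> (nat \<Rightarrow> physical_machine) \<Rightarrow> real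
    \<Rightarrow> (nat \<Rightarrow> nat) \<Rightarrow> real" where
  "total_energy n m vm M E0 S =
     E0 * (\<Sum>j=1..m. busy_time n vm S j) + (\<Sum>i=1..n. vm_energy vm M S i)"

end

(* On identical machines the energy of each virtual machine does not depend on the machine that
   runs it, so the total energy is a strictly increasing affine function of the total busy time. *)
theory Submission
  imports Defs
begin

text \<open>Running on identical machines, a virtual machine uses the same energy under every
  feasible schedule (\<open>sum_vm_energy_eq\<close>). Total energies of two feasible schedules thus
  differ by \<open>E0\<close> times the difference of their total busy times, and
  \<open>E0 > 0\<close> preserves strict order (\<open>total_energy_less_iff\<close>).\<close>

lemma feasible_range:
  assumes "feasible n m d vm M S" and "i \<in> {1..n}"
  shows "S i \<in> {1..m}"
  using assms unfolding feasible_def schedules_def by (auto dest: PiE_mem)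

lemma sum_vm_energy_eq:
  assumes "\<And>j k. j \<in> {1..m} \<Longrightarrow> k \<in> {1..m} \<Longrightarrow> M j = M k"
    and "feasible n m d vm M S" and "feasible n m d vm M S'"
  shows "(\<Sum>i=1..n. vm_energy vm M S i) = (\<Sum>i=1..n. vm_energy vm M S' i)"
proof (rule sum.cong)
  fix i assume "i \<in> {1..n}"
  \<comment> \<open>Machines are assumed equal only for indices in \<open>{1..m}\<close>, so both
    assignments must be known to lie there.\<close>
  then have "M (S i) = M (S' i)"
    using assms by (blast intro: feasible_range)
  then show "vm_energy vm M S i = vm_energy vm M S' i"
    by (simp add: vm_energy_def)
qed simp

text \<open>Stated with \<open><\<close> because \<open>is_arg_min\<close> excludes a strictly
  smaller feasible competitor, here \<open>S'\<close>.\<close>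

lemma total_energy_less_iff:
  assumes "\<And>j k. j \<in> {1..m} \<Longrightarrow> k \<in> {1..m} \<Longrightarrow> M j = M k" and "E0 > 0"
    and "feasible n m d vm M S" and "feasible n m d vm M S'"
  shows "total_energy n m vm M E0 S' < total_energy n m vm M E0 S \<longleftrightarrow>
         total_busy_time n m vm S' < total_busy_time n m vm S"
  using sum_vm_energy_eq[OF assms(1,3,4)] \<open>E0 > 0\<close>
  by (simp add: total_energy_def total_busy_time_def)

theorem theorem2:
  fixes n m d :: nat
    and vm :: "nat \<Rightarrow> virtual_machine"
    and M :: "nat \<Rightarrow> physical_machine"
    and E0 :: real
    and S :: "nat \<Rightarrow> nat"
  assumes "\<And>i. i \<in> {1..n} \<Longrightarrow> duration (vm i) \<ge> 0"
    and "\<And>i r. i \<in> {1..n} \<Longrightarrow> r \<in> {1..d} \<Longrightarrow> demand (vm i) r \<ge> 0"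
    and "\<And>i. i \<in> {1..n} \<Longrightarrow> cpu_utilization (vm i) \<in> {0..1}"
    and identical: "\<And>j k. j \<in> {1..m} \<Longrightarrow> k \<in> {1..m} \<Longrightarrow> M j = M k"
    and "E0 > 0"
    and "feasible n m d vm M S"
  shows "is_arg_min (total_energy n m vm M E0) (feasible n m d vm M) S \<longleftrightarrow>
         is_arg_min (total_busy_time n m vm) (feasible n m d vm M) S"
  using total_energy_less_iff[OF identical \<open>E0 > 0\<close> \<open>feasible n m d vm M S\<close>]
  by (auto simp: is_arg_min_def)

end
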